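(* Let $n\ge 1$ and let $A,B\in M_n(\mathbb{C})$ be positive semidefinite matrices. Then for every $j\in\{1,2,\dots,n\}$ and every real $t\in(-2,2]$, $$(2+t)\,s_j\left(A^{1/2}B^{3/2}+A^{3/2}B^{1/2}\right)\le 2\,s_j\left(A^2+tAB+B^2\right).$$
   Context: $M_n(\mathbb{C})$ denotes the $n\times n$ complex matrices. For $X\in M_n(\mathbb{C})$, $s_1(X)\ge s_2(X)\ge\dots\ge s_n(X)$ denote the singular values of $X$ arranged in non-increasing order and counted with multiplicity. Fractional powers of positive semidefinite matrices are the positive semidefinite ones given by the functional calculus (so $A^{3/2}=A\cdot A^{1/2}$). *)

theory Defs
  imports
    "Jordan_Normal_Form.Schur_Decomposition"
    "HOL-Computational_Algebra.Fundamental_Theorem_Algebra"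
begin

definition positive_semidefinite :: "complex mat \<Rightarrow> bool" where
  "positive_semidefinite A \<longleftrightarrow>
     square_mat A \<and> mat_adjoint A = A \<and>
     (\<forall>v \<in> carrier_vec (dim_row A). 0 \<le> Re ((A *\<^sub>v v) \<bullet>c v))"

definition unitary_mat :: "complex mat \<Rightarrow> bool" where
  "unitary_mat U \<longleftrightarrow> square_mat U \<and> mat_adjoint U * U = 1\<^sub>m (dim_row U)"

text \<open>
  Functional calculus of Hermitian matrices, by unitary diagonalisation
  \<open>A = U diag(d) U\<^sup>*\<close>. The result does not depend on the choice of \<open>U\<close> and \<open>d\<close>, see
  \<open>spectral_fun_unique\<close>; for matrices that are not Hermitian it is unspecified.
\<close>

definition is_spectral_fun :: "(real \<Rightarrow> real) \<Rightarrow> complex mat \<Rightarrow> complex mat \<Rightarrow> bool" where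
  "is_spectral_fun f A F \<longleftrightarrow>
     (\<exists>U d. unitary_mat U \<and> dim_row U = dim_row A \<and>
        A = U * mat_diag (dim_row A) (\<lambda>i. complex_of_real (d i)) * mat_adjoint U \<and>
        F = U * mat_diag (dim_row A) (\<lambda>i. complex_of_real (f (d i))) * mat_adjoint U)"

definition spectral_fun :: "(real \<Rightarrow> real) \<Rightarrow> complex mat \<Rightarrow> complex mat" where
  "spectral_fun f A = (THE F. is_spectral_fun f A F)"

text \<open>Meant for positive semidefinite \<open>A\<close> and \<open>r > 0\<close>; note that \<open>0 powr r = 0\<close>.\<close>

definition mat_powr :: "complex mat \<Rightarrow> real \<Rightarrow> complex mat" where
  "mat_powr A r = spectral_fun (\<lambda>x. x powr r) A"

text \<open>
  The singular values of \<open>X\<close> are the square roots of the eigenvalues of \<open>X\<^sup>* X\<close>, counted with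
  multiplicity. These eigenvalues are real and nonnegative, so taking the real part only
  changes the type.
\<close>

definition singular_values :: "complex mat \<Rightarrow> real list" where
  "singular_values X =
     rev (sorted_list_of_multiset
       (image_mset (\<lambda>z. sqrt (Re z)) (proots (char_poly (mat_adjoint X * X)))))"

text \<open>The index starts at 1: \<open>singular_value X 1\<close> is the largest singular value.\<close>

definition singular_value :: "complex mat \<Rightarrow> nat \<Rightarrow> real" where
  "singular_value X j = singular_values X ! (j - 1)"

lemma mat_adjoint_carrier:
  "X \<in> carrier_mat n m \<Longrightarrow> mat_adjoint X \<in> carrier_mat m n"
  unfolding mat_adjoint_def by (auto simp: mat_of_rows_def)

lemma length_singular_values:
  assumes "X \<in> carrier_mat n n"
  shows "length (singular_values X) = n"
proof -
  have "mat_adjoint X * X \<in> carrier_mat n n"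
    using assms mat_adjoint_carrier[OF assms] by auto
  hence "degree (char_poly (mat_adjoint X * X)) = n"
    using degree_monic_char_poly by blast
  thus ?thesis
    unfolding singular_values_def
    by (metis length_rev mset_sorted_list_of_multiset size_image_mset size_mset size_proots_complex)
qed

lemma antimono_singular_values:
  "sorted_wrt (\<ge>) (singular_values X)"
  unfolding singular_values_def sorted_wrt_rev by simp

lemma unitary_matD:
  assumes "unitary_mat U" "dim_row U = n"
  shows "U \<in> carrier_mat n n" "mat_adjoint U \<in> carrier_mat n n"
    "mat_adjoint U * U = 1\<^sub>m n" "U * mat_adjoint U = 1\<^sub>m n"
proof -
  show U: "U \<in> carrier_mat n n" using assms unfolding unitary_mat_def by auto
  show U': "mat_adjoint U \<in> carrier_mat n n" by (rule mat_adjoint_carrier[OF U])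
  show "mat_adjoint U * U = 1\<^sub>m n" using assms unfolding unitary_mat_def by auto
  thus "U * mat_adjoint U = 1\<^sub>m n" by (rule mat_mult_left_right_inverse[OF U' U])
qed

lemma spectral_fun_unique:
  assumes "is_spectral_fun f A F" "is_spectral_fun f A G"
  shows "F = G"
proof -
  define n where "n = dim_row A"
  define D where "D = (\<lambda>d :: nat \<Rightarrow> real. mat_diag n (\<lambda>i. complex_of_real (d i)))"
  have D: "D d \<in> carrier_mat n n" for d unfolding D_def by simp
  have dD [simp]: "dim_row (D d) = n" "dim_col (D d) = n" for d using D[of d] by auto
  obtain U d where U: "unitary_mat U" "dim_row U = n"
    and A1: "A = U * D d * mat_adjoint U" and F: "F = U * D (\<lambda>i. f (d i)) * mat_adjoint U"
    using assms(1) unfolding is_spectral_fun_def n_def D_def by auto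
  obtain V e where V: "unitary_mat V" "dim_row V = n"
    and A2: "A = V * D e * mat_adjoint V" and G: "G = V * D (\<lambda>i. f (e i)) * mat_adjoint V"
    using assms(2) unfolding is_spectral_fun_def n_def D_def by auto
  note u = unitary_matD[OF U] and v = unitary_matD[OF V]
  define W where "W = mat_adjoint V * U"
  have W: "W \<in> carrier_mat n n" unfolding W_def using u v by auto
  have conj: "mat_adjoint V * (U * X * mat_adjoint U) * U = W * X"
    if X: "X \<in> carrier_mat n n" for X
  proof -
    have "mat_adjoint V * (U * X * mat_adjoint U) * U
        = mat_adjoint V * U * X * (mat_adjoint U * U)"
      using u(1,2) v(1,2) X by (simp add: assoc_mult_mat[of _ n n _ n _ n])
    thus ?thesis using u X W unfolding W_def by simp
  qed
  have conj': "mat_adjoint V * (V * X * mat_adjoint V) * U = X * W"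
    if X: "X \<in> carrier_mat n n" for X
  proof -
    have "mat_adjoint V * (V * X * mat_adjoint V) * U
        = (mat_adjoint V * V) * (X * W)"
      unfolding W_def using u(1,2) v(1,2) X by (simp add: assoc_mult_mat[of _ n n _ n _ n])
    thus ?thesis using v X W by simp
  qed
  have comm: "W * D d = D e * W"
    unfolding conj[OF D, symmetric] conj'[OF D, symmetric] A1[symmetric] A2[symmetric] ..
  have ent: "(W * D g) $$ (i,j) = W $$ (i,j) * g j" "(D g * W) $$ (i,j) = g i * W $$ (i,j)"
    if "i < n" "j < n" for g i j
    unfolding D_def using that by (simp_all add: mat_diag_mult_right[OF W] mat_diag_mult_left[OF W])
  have "W * D (\<lambda>i. f (d i)) = D (\<lambda>i. f (e i)) * W"
  proof (rule eq_matI)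
    fix i j assume "i < dim_row (D (\<lambda>i. f (e i)) * W)" "j < dim_col (D (\<lambda>i. f (e i)) * W)"
    hence ij: "i < n" "j < n" using W D by auto
    have "W $$ (i,j) * d j = e i * W $$ (i,j)"
      using ent(1)[OF ij, of d] ent(2)[OF ij, of e] unfolding comm by (rule trans[OF sym])
    hence "W $$ (i,j) = 0 \<or> d j = e i" by (auto simp: mult.commute)
    thus "(W * D (\<lambda>i. f (d i))) $$ (i,j) = (D (\<lambda>i. f (e i)) * W) $$ (i,j)"
      using ent[OF ij] by auto
  qed (use W D in auto)
  hence eq: "mat_adjoint V * F * U = mat_adjoint V * G * U"
    unfolding F G conj[OF D] conj'[OF D] .
  have Fc: "F \<in> carrier_mat n n" "G \<in> carrier_mat n n" unfolding F G using u v D by auto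
  have inv_conj: "V * (mat_adjoint V * X * U) * mat_adjoint U = X" if X: "X \<in> carrier_mat n n" for X
  proof -
    have "V * (mat_adjoint V * X * U) * mat_adjoint U
        = (V * mat_adjoint V) * (X * (U * mat_adjoint U))"
      using u(1,2) v(1,2) X by (simp add: assoc_mult_mat[of _ n n _ n _ n])
    thus ?thesis using u v X by simp
  qed
  have "F = V * (mat_adjoint V * F * U) * mat_adjoint U" by (rule inv_conj[OF Fc(1), symmetric])
  also have "\<dots> = G" unfolding eq by (rule inv_conj[OF Fc(2)])
  finally show ?thesis .
qed

lemma spectral_fun_eqI: "is_spectral_fun f A F \<Longrightarrow> spectral_fun f A = F"
  unfolding spectral_fun_def by (rule the_equality) (auto intro: spectral_fun_unique)

end

theory Submission
  imports Defs
begin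

text \<open>
  Put \<open>a = A\<^sup>1\<^sup>/\<^sup>2\<close>, \<open>b = B\<^sup>1\<^sup>/\<^sup>2\<close> and \<open>H = A + B\<close>. The matrix on the left is \<open>a H b\<close>, and the claim follows from
  \<open>2 s\<^sub>j(a H b) \<le> s\<^sub>j(H)\<^sup>2\<close> and \<open>(2 + t) s\<^sub>j(H)\<^sup>2 \<le> 4 s\<^sub>j(K)\<close>, where \<open>K = A\<^sup>2 + t A B + B\<^sup>2\<close>.

  For the second inequality, the Hermitian part of \<open>K\<close> is
  \<open>(2 + t)/4 (A + B)\<^sup>2 + (2 - t)/4 (A - B)\<^sup>2\<close>, which dominates \<open>(2 + t)/4 H\<^sup>2\<close>; the singular values of
  a matrix dominate the eigenvalues of its Hermitian part.

  For the first one, let \<open>T\<close> be the block column with entries \<open>a\<close> and \<open>b\<close>. Then \<open>T\<^sup>* T = H\<close>, and \<open>a H b\<close> is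
  the off-diagonal block of the positive semidefinite matrix \<open>T H T\<^sup>* = (T T\<^sup>*)\<^sup>2\<close>, whose nonzero
  eigenvalues are those of \<open>H\<^sup>2\<close>. Flipping the sign of one block coordinate shows that twice an
  off-diagonal block is dominated by the whole matrix. Both inequalities are obtained from
  vectors on which one matrix is bounded below and another one above by its \<open>j\<close>-th singular value.
\<close>

section \<open>Unitary diagonalisation of Hermitian matrices\<close>

lemma mat_adjoint_dim [simp]:
  "dim_row (mat_adjoint A) = dim_col A" "dim_col (mat_adjoint A) = dim_row A"
  unfolding mat_adjoint_def by (auto simp: mat_of_rows_def)

lemma mat_adjoint_index [simp]:
  assumes "i < dim_col A" "j < dim_row A"
  shows "mat_adjoint A $$ (i, j) = conjugate (A $$ (j, i))"
  unfolding mat_adjoint_def using assms by (simp add: mat_of_rows_def)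

lemma mat_adjoint_mult:
  fixes A B :: "complex mat"
  assumes "A \<in> carrier_mat n m" "B \<in> carrier_mat m k"
  shows "mat_adjoint (A * B) = mat_adjoint B * mat_adjoint A"
  using assms
  by (intro eq_matI) (auto simp: scalar_prod_def mult.commute)

lemma mat_adjoint_adjoint [simp]:
  fixes A :: "complex mat"
  shows "mat_adjoint (mat_adjoint A) = A"
  by (intro eq_matI) auto

lemma mat_adjoint_mat_diag:
  "mat_adjoint (mat_diag n d) = mat_diag n (\<lambda>i. cnj (d i))"
  by (intro eq_matI) (auto simp: mat_diag_def)

lemma mat_adjoint_four_block_diag:
  fixes B :: "complex mat"
  assumes "B \<in> carrier_mat m m"
  shows "mat_adjoint (four_block_mat (1\<^sub>m 1) (0\<^sub>m 1 m) (0\<^sub>m m 1) B)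
    = four_block_mat (1\<^sub>m 1) (0\<^sub>m 1 m) (0\<^sub>m m 1) (mat_adjoint B)"
  using assms by (intro eq_matI) (auto simp: four_block_mat_def)

lemma four_block_diag_mult:
  fixes A :: "'a :: semiring_1 mat"
  assumes "A \<in> carrier_mat k k" "A' \<in> carrier_mat k k" "B \<in> carrier_mat m m" "B' \<in> carrier_mat m m"
  shows "four_block_mat A (0\<^sub>m k m) (0\<^sub>m m k) B * four_block_mat A' (0\<^sub>m k m) (0\<^sub>m m k) B'
    = four_block_mat (A * A') (0\<^sub>m k m) (0\<^sub>m m k) (B * B')"
  using assms by (subst mult_four_block_mat[of _ k k _ m _ m _ _ k _ m]) auto

text \<open>Gram-Schmidt on a basis completing \<open>v\<close> keeps its first vector, so after
  normalisation the first column still spans the line of \<open>v\<close>. Only that line matters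
  for deflation, hence the unspecified factor \<open>c\<close>.\<close>

lemma exists_unitary_first_col:
  fixes v :: "complex vec"
  assumes v: "v \<in> carrier_vec n" and v0: "v \<noteq> 0\<^sub>v n"
  obtains W c where "W \<in> carrier_mat n n" "mat_adjoint W * W = 1\<^sub>m n" "col W 0 = c \<cdot>\<^sub>v v"
proof -
  interpret cof_vec_space n "TYPE(complex)" .
  define b where "b = basis_completion v"
  define ws where "ws = gram_schmidt n b"
  have n: "n \<noteq> 0" using v v0 by auto
  from basis_completion[OF v v0, folded b_def]
  have dist_b: "distinct b" and indep: "\<not> lin_dep (set b)" and b: "set b \<subseteq> carrier_vec n"
    and hdb: "hd b = v" and len_b: "length b = n" by auto
  from hdb len_b n obtain vs where bv: "b = v # vs" by (cases b) auto
  from gram_schmidt_result[OF b dist_b indep refl, folded ws_def]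
  have ws: "set ws \<subseteq> carrier_vec n" "corthogonal ws" "length ws = n" by (auto simp: len_b)
  from gram_schmidt_hd[OF v, of vs, folded bv] have hdws: "hd ws = v" unfolding ws_def .
  have ws0: "ws ! 0 = v" using hdws ws(3) n by (simp add: hd_conv_nth flip: length_0_conv)
  have wsi: "ws ! i \<in> carrier_vec n" if "i < n" for i using ws that by auto
  \<comment> \<open>\<open>gram_schmidt\<close> yields orthogonal but not normalised vectors;
    \<open>r i\<close> is the reciprocal length of the \<open>i\<close>-th one.\<close>
  define r where "r i = complex_of_real (1 / sqrt (Re (ws ! i \<bullet>c ws ! i)))" for i
  define W where "W = mat_of_cols n (map (\<lambda>i. r i \<cdot>\<^sub>v ws ! i) [0..<n])"
  have W: "W \<in> carrier_mat n n" unfolding W_def by (auto simp: mat_of_cols_def)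
  have cW: "col W i = r i \<cdot>\<^sub>v ws ! i" if "i < n" for i
    unfolding W_def using that wsi[OF that] by (subst col_mat_of_cols) auto
  have "mat_adjoint W * W = 1\<^sub>m n"
  proof (rule eq_matI)
    fix i j assume "i < dim_row (1\<^sub>m n :: complex mat)" "j < dim_col (1\<^sub>m n :: complex mat)"
    hence ij: "i < n" "j < n" by auto
    have "(mat_adjoint W * W) $$ (i, j) = conjugate (col W i) \<bullet> col W j"
      using ij W unfolding mat_adjoint_def by simp
    also have "\<dots> = conjugate (r i) * r j * (conjugate (ws ! i) \<bullet> ws ! j)"
      using cW ij wsi[OF ij(1)] wsi[OF ij(2)]
      by (simp add: conjugate_smult_vec smult_scalar_prod_distrib[of _ n] scalar_prod_smult_distrib[of _ n])
    also have "conjugate (ws ! i) \<bullet> ws ! j = ws ! j \<bullet>c ws ! i"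
      using conjugate_vec_sprod_comm[OF wsi[OF ij(2)] wsi[OF ij(1)]] by simp
    also have "conjugate (r i) * r j * (ws ! j \<bullet>c ws ! i) = (if i = j then 1 else 0)"
    proof (cases "i = j")
      case False
      thus ?thesis using corthogonalD[OF ws(2), of j i] ws(3) ij by auto
    next
      case True
      define q where "q = ws ! i \<bullet>c ws ! i"
      have "q \<noteq> 0" using corthogonalD[OF ws(2), of i i] ws(3) ij unfolding q_def by auto
      moreover have "q \<ge> 0" unfolding q_def by (rule conjugate_square_ge_0_vec)
      ultimately have q: "q = complex_of_real (Re q)" "Re q > 0"
        by (auto simp: less_eq_complex_def complex_eq_iff)
      have "cnj (r i) * r i = complex_of_real (1 / Re q)"
        unfolding r_def q_def[symmetric] using q(2)
        by (simp flip: of_real_mult of_real_divide)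
      hence "cnj (r i) * r i * q = complex_of_real (1 / Re q) * complex_of_real (Re q)"
        using q(1) by simp
      hence "cnj (r i) * r i * q = 1" using q(2) by (simp flip: of_real_mult)
      thus ?thesis using True by (simp add: q_def)
    qed
    finally show "(mat_adjoint W * W) $$ (i, j) = 1\<^sub>m n $$ (i, j)" using ij by simp
  qed (use W in auto)
  moreover have "col W 0 = r 0 \<cdot>\<^sub>v v" using cW[of 0] n ws0 by simp
  ultimately show thesis using W that by blast
qed

text \<open>Deflation: split off an eigenvector for the first root and recurse on the remaining
  block. The diagonal follows the given order of \<open>es\<close>, which later allows the
  eigenvalues of \<open>X\<^sup>* X\<close> to be listed in the order of the singular
  values.\<close>

theorem hermitian_unitary_diagonalisation:
  fixes A :: "complex mat"
  assumes "A \<in> carrier_mat n n" "mat_adjoint A = A" "char_poly A = (\<Prod>e\<leftarrow>es. [:- e, 1:])"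
  shows "\<exists>U \<in> carrier_mat n n. mat_adjoint U * U = 1\<^sub>m n \<and>
    A = U * mat_diag n (\<lambda>i. es ! i) * mat_adjoint U"
  using assms
proof (induction es arbitrary: n A)
  case Nil
  hence "n = 0" using degree_monic_char_poly[of A n] by auto
  thus ?case using Nil by (intro bexI[of _ "1\<^sub>m n"]) (auto intro!: eq_matI)
next
  case (Cons e es n A)
  define m where "m = n - 1"
  note A = Cons.prems(1)
  let ?cp = "char_poly A"
  have cp: "?cp = [:-e, 1:] * (\<Prod>e\<leftarrow>es. [:- e, 1:])" using Cons.prems(3) by simp
  have mon: "monic (\<Prod>e\<leftarrow>es. [:- e, 1:])" by (rule monic_prod_list) auto
  have "degree ?cp = Suc (degree (\<Prod>e\<leftarrow>es. [:- e, 1:]))"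
    unfolding cp by (subst degree_mult_eq) (use mon in auto)
  with degree_monic_char_poly[OF A] have n: "n = Suc m" by (auto simp: m_def)
  have "eigenvalue A e" unfolding eigenvalue_root_char_poly[OF A] cp by simp
  then obtain v where v: "v \<in> carrier_vec n" "v \<noteq> 0\<^sub>v n" and ev: "A *\<^sub>v v = e \<cdot>\<^sub>v v"
    using A unfolding eigenvalue_def eigenvector_def by auto
  from exists_unitary_first_col[OF v] obtain W c where W: "W \<in> carrier_mat n n"
    and WW: "mat_adjoint W * W = 1\<^sub>m n" and W0: "col W 0 = c \<cdot>\<^sub>v v" .
  have W': "mat_adjoint W \<in> carrier_mat n n" using W by (rule mat_adjoint_carrier)
  have WW': "W * mat_adjoint W = 1\<^sub>m n" by (rule mat_mult_left_right_inverse[OF W' W WW])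
  define A' where "A' = mat_adjoint W * A * W"
  have A': "A' \<in> carrier_mat n n" unfolding A'_def using W W' A by auto
  have herm: "mat_adjoint A' = A'"
    unfolding A'_def using W W' A Cons.prems(2)
    by (simp add: mat_adjoint_mult[of _ n n _ n] assoc_mult_mat[of _ n n _ n _ n])
  have AA': "A = W * A' * mat_adjoint W"
  proof -
    have "W * A' * mat_adjoint W = (W * mat_adjoint W) * A * (W * mat_adjoint W)"
      unfolding A'_def using W W' A by (simp add: assoc_mult_mat[of _ n n _ n _ n])
    thus ?thesis using WW' A by simp
  qed
  \<comment> \<open>The first column of \<open>W\<close> is an eigenvector of \<open>A\<close>, so
    conjugating by \<open>W\<close> turns the first column of \<open>A\<close> into \<open>e\<close>
    times the first unit vector.\<close>
  have "A *\<^sub>v col W 0 = e \<cdot>\<^sub>v col W 0"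
    unfolding W0 using A v ev by (simp add: mult_mat_vec[of _ n n] smult_smult_assoc mult.commute)
  moreover have "col A' 0 = mat_adjoint W *\<^sub>v (A *\<^sub>v col W 0)"
    unfolding A'_def assoc_mult_mat[OF W' A W]
    using col_mult2[OF W' mult_carrier_mat[OF A W], of 0] col_mult2[OF A W, of 0] n by simp
  ultimately have "col A' 0 = mat_adjoint W *\<^sub>v (e \<cdot>\<^sub>v col W 0)" by simp
  also have "\<dots> = e \<cdot>\<^sub>v col (mat_adjoint W * W) 0"
    using mult_mat_vec[OF W' col_carrier_vec[OF _ W], of 0 e] col_mult2[OF W' W, of 0] n by simp
  finally have col0: "col A' 0 = e \<cdot>\<^sub>v unit_vec n 0" unfolding WW using n by simp
  have c0: "A' $$ (i, 0) = (if i = 0 then e else 0)" if "i < n" for i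
    using arg_cong[OF col0, of "\<lambda>v. v $ i"] that A' n by auto
  \<comment> \<open>Hermitian symmetry carries the zeros of the first column over to the first row,
    so \<open>A'\<close> splits into the blocks \<open>E\<close> and \<open>A3\<close>.\<close>
  have r0: "A' $$ (0, i) = (if i = 0 then e else 0)" if "i < n" for i
  proof (cases "i = 0")
    case False
    have "A' $$ (0, i) = mat_adjoint A' $$ (0, i)" unfolding herm ..
    also have "\<dots> = cnj (A' $$ (i, 0))" using A' that n by (subst mat_adjoint_index) auto
    finally show ?thesis using c0[OF that] False by simp
  qed (use c0[OF that] in auto)
  define A3 where "A3 = mat m m (\<lambda>(i, j). A' $$ (Suc i, Suc j))"
  have A3: "A3 \<in> carrier_mat m m" unfolding A3_def by simp
  define E where "E = mat 1 1 (\<lambda>_. e)"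
  have E: "E \<in> carrier_mat 1 1" unfolding E_def by simp
  have block: "A' = four_block_mat E (0\<^sub>m 1 m) (0\<^sub>m m 1) A3"
    using A' n c0 r0 by (intro eq_matI) (auto simp: E_def A3_def four_block_mat_def)
  have "mat_adjoint A3 = A3"
  proof (rule eq_matI)
    fix i j assume "i < dim_row A3" "j < dim_col A3"
    hence ij: "i < m" "j < m" by (auto simp: A3_def)
    have "mat_adjoint A' $$ (Suc i, Suc j) = cnj (A' $$ (Suc j, Suc i))"
      using A' n ij by (subst mat_adjoint_index) auto
    thus "mat_adjoint A3 $$ (i, j) = A3 $$ (i, j)"
      unfolding herm using ij by (simp add: A3_def)
  qed (auto simp: A3_def)
  \<comment> \<open>Similarity preserves the characteristic polynomial, and the block form makes it
    a product; cancelling the factor of \<open>e\<close> leaves the roots \<open>es\<close> for the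
    induction hypothesis.\<close>
  moreover have "char_poly A3 = (\<Prod>e\<leftarrow>es. [:- e, 1:])"
  proof -
    have "similar_mat_wit A A' W (mat_adjoint W)"
      by (rule similar_mat_witI[of _ _ n]) (use W W' A A' WW WW' AA' in auto)
    hence "?cp = char_poly A'" using char_poly_similar unfolding similar_mat_def by blast
    also have "\<dots> = char_poly E * char_poly A3"
      unfolding block by (rule char_poly_four_block_zeros_col[OF E _ A3]) auto
    also have "char_poly E = [:-e, 1:]" by (simp add: E_def char_poly_defs det_def sign_def)
    finally show ?thesis unfolding cp by (metis mult_cancel_left pCons_eq_0_iff zero_neq_one)
  qed
  ultimately obtain U where U: "U \<in> carrier_mat m m" and UU: "mat_adjoint U * U = 1\<^sub>m m"
    and A3U: "A3 = U * mat_diag m (\<lambda>i. es ! i) * mat_adjoint U"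
    using Cons.IH[OF A3] by blast
  have U': "mat_adjoint U \<in> carrier_mat m m" using U by (rule mat_adjoint_carrier)
  \<comment> \<open>Padding \<open>U\<close> with a 1 leaves the eigenvector already found in place;
    \<open>W * V\<close> then diagonalises \<open>A\<close>.\<close>
  define V where "V = four_block_mat (1\<^sub>m 1) (0\<^sub>m 1 m) (0\<^sub>m m 1) U"
  have V: "V \<in> carrier_mat n n" unfolding V_def using U n by (metis four_block_carrier_mat one_carrier_mat plus_1_eq_Suc)
  have V'_eq: "mat_adjoint V = four_block_mat (1\<^sub>m 1) (0\<^sub>m 1 m) (0\<^sub>m m 1) (mat_adjoint U)"
    unfolding V_def by (rule mat_adjoint_four_block_diag[OF U])
  have V': "mat_adjoint V \<in> carrier_mat n n" using V by (rule mat_adjoint_carrier)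
  define D where "D = mat_diag n (\<lambda>i. (e # es) ! i)"
  have D: "D \<in> carrier_mat n n" unfolding D_def by simp
  have D_block: "D = four_block_mat E (0\<^sub>m 1 m) (0\<^sub>m m 1) (mat_diag m (\<lambda>i. es ! i))"
    using n by (intro eq_matI) (auto simp: D_def E_def mat_diag_def four_block_mat_def nth_Cons')
  have VV: "mat_adjoint V * V = 1\<^sub>m n"
    unfolding V'_eq unfolding V_def using U U' UU n
    by (simp add: four_block_diag_mult[of _ 1 _ _ m] del: One_nat_def) simp
  have A'V: "A' = V * D * mat_adjoint V"
    unfolding V'_eq unfolding V_def D_block block A3U using U U' E
    by (simp add: four_block_diag_mult[of _ 1 _ _ m] del: One_nat_def)
  have "mat_adjoint (W * V) * (W * V) = mat_adjoint V * (mat_adjoint W * W) * V"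
    using W W' V V' by (simp add: mat_adjoint_mult[of _ n n _ n] assoc_mult_mat[of _ n n _ n _ n])
  hence "mat_adjoint (W * V) * (W * V) = 1\<^sub>m n" unfolding WW using V V' VV by simp
  moreover have "A = (W * V) * D * mat_adjoint (W * V)"
    unfolding AA' unfolding A'V
    using W W' V V' D by (simp add: mat_adjoint_mult[of _ n n _ n] assoc_mult_mat[of _ n n _ n _ n])
  ultimately show ?case using W V unfolding D_def by (intro bexI[of _ "W * V"]) auto
qed

section \<open>The real inner product\<close>

text \<open>On complex vectors this is a symmetric real bilinear form, so that everything below
  becomes real algebra with quadratic forms.\<close>

definition rinner :: "complex vec \<Rightarrow> complex vec \<Rightarrow> real" where
  "rinner x y = Re (x \<bullet>c y)"

lemma rinner_sum:
  "rinner x y = (\<Sum>i<dim_vec y. Re (x $ i * cnj (y $ i)))"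
  unfolding rinner_def scalar_prod_def by (auto simp: lessThan_atLeast0)

lemma rinner_self_sum: "rinner x x = (\<Sum>i<dim_vec x. (cmod (x $ i))\<^sup>2)"
  unfolding rinner_sum by (intro sum.cong) (auto simp: cmod_def power2_eq_square)

lemma rinner_nonneg [simp]: "rinner x x \<ge> 0"
  unfolding rinner_self_sum by (intro sum_nonneg) auto

lemma rinner_pos:
  assumes "x \<in> carrier_vec n" "x \<noteq> 0\<^sub>v n"
  shows "rinner x x > 0"
proof -
  obtain i where "i < n" "x $ i \<noteq> 0" using assms by (auto simp: vec_eq_iff)
  hence "0 < (\<Sum>i<dim_vec x. (cmod (x $ i))\<^sup>2)"
    using assms by (intro sum_pos2[of _ i]) auto
  thus ?thesis unfolding rinner_self_sum .
qed

lemma rinner_commute: "dim_vec x = dim_vec y \<Longrightarrow> rinner x y = rinner y x"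
  unfolding rinner_sum by (intro sum.cong) (auto simp: mult.commute)

lemma rinner_add_left:
  "x \<in> carrier_vec n \<Longrightarrow> y \<in> carrier_vec n \<Longrightarrow> z \<in> carrier_vec n \<Longrightarrow>
    rinner (x + y) z = rinner x z + rinner y z"
  unfolding rinner_sum by (auto simp: algebra_simps sum.distrib)

lemma rinner_add_right:
  "x \<in> carrier_vec n \<Longrightarrow> y \<in> carrier_vec n \<Longrightarrow> z \<in> carrier_vec n \<Longrightarrow>
    rinner z (x + y) = rinner z x + rinner z y"
  unfolding rinner_sum by (auto simp: algebra_simps sum.distrib)

lemma rinner_smult_left:
  "x \<in> carrier_vec n \<Longrightarrow> y \<in> carrier_vec n \<Longrightarrow>
    rinner (complex_of_real r \<cdot>\<^sub>v x) y = r * rinner x y"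
  unfolding rinner_sum by (auto simp: algebra_simps sum_distrib_left)

lemma rinner_smult_right:
  "x \<in> carrier_vec n \<Longrightarrow> y \<in> carrier_vec n \<Longrightarrow>
    rinner y (complex_of_real r \<cdot>\<^sub>v x) = r * rinner y x"
  unfolding rinner_sum by (auto simp: algebra_simps sum_distrib_left)

lemma rinner_adjoint:
  assumes "A \<in> carrier_mat n m" "x \<in> carrier_vec m" "y \<in> carrier_vec n"
  shows "rinner (A *\<^sub>v x) y = rinner x (mat_adjoint A *\<^sub>v y)"
proof -
  have "(A *\<^sub>v x) \<bullet>c y = (\<Sum>i<n. \<Sum>k<m. A $$ (i, k) * x $ k * cnj (y $ i))"
    using assms by (auto simp: scalar_prod_def lessThan_atLeast0 sum_distrib_right)
  also have "\<dots> = (\<Sum>k<m. \<Sum>i<n. A $$ (i, k) * x $ k * cnj (y $ i))" by (rule sum.swap)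
  also have "\<dots> = x \<bullet>c (mat_adjoint A *\<^sub>v y)"
    using assms by (auto simp: scalar_prod_def lessThan_atLeast0 sum_distrib_left algebra_simps)
  finally show ?thesis unfolding rinner_def by simp
qed

text \<open>Expand the squared norm of \<open>h x - y\<close> and divide by \<open>h\<close>. The
  free weight \<open>h\<close> is what allows terms to be absorbed later.\<close>

lemma rinner_le_AM_GM:
  assumes x: "x \<in> carrier_vec n" and y: "y \<in> carrier_vec n" and h: "h > 0"
  shows "2 * rinner x y \<le> h * rinner x x + rinner y y / h"
proof -
  let ?w = "complex_of_real h \<cdot>\<^sub>v x + complex_of_real (-1) \<cdot>\<^sub>v y"
  have "rinner y x = rinner x y" using rinner_commute x y by simp
  hence "rinner ?w ?w = h * h * rinner x x - 2 * h * rinner x y + rinner y y"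
    using x y
    by (simp del: of_real_minus add: rinner_add_left[of _ n] rinner_add_right[of _ n]
        rinner_smult_left[of _ n] rinner_smult_right[of _ n] algebra_simps)
  moreover have "0 \<le> rinner ?w ?w" by simp
  ultimately have "2 * h * rinner x y \<le> h * (h * rinner x x) + rinner y y" by simp
  thus ?thesis using h by (simp add: field_simps)
qed

text \<open>This is Cauchy-Schwarz for a norm bound known at a single vector. It is the previous
  inequality with weight \<open>1 / h\<close>; for \<open>h = 0\<close> the vector \<open>x\<close>
  vanishes.\<close>

lemma rinner_le_of_norm_le:
  assumes x: "x \<in> carrier_vec n" and y: "y \<in> carrier_vec n" and h: "h \<ge> 0"
    and le: "rinner x x \<le> h\<^sup>2 * rinner y y"
  shows "rinner x y \<le> h * rinner y y"
proof (cases "h = 0")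
  case True
  hence "rinner x x = 0" using le rinner_nonneg[of x] by simp
  hence "x = 0\<^sub>v n" using rinner_pos[OF x] by force
  thus ?thesis using True y by (simp add: rinner_sum)
next
  case False
  hence h: "h > 0" using assms by simp
  have "2 * rinner x y \<le> (1 / h) * rinner x x + rinner y y / (1 / h)"
    using h by (intro rinner_le_AM_GM[OF x y]) simp
  moreover have "(1 / h) * rinner x x \<le> h * rinner y y"
    using le h by (simp add: field_simps power2_eq_square)
  ultimately show ?thesis by (simp add: mult.commute)
qed

section \<open>Quadratic forms in unitary coordinates\<close>

lemma char_poly_complex_factor:
  fixes A :: "complex mat"
  assumes "A \<in> carrier_mat n n" "mset es = proots (char_poly A)"
  shows "char_poly A = (\<Prod>e\<leftarrow>es. [:- e, 1:])"
proof -
  have "char_poly A = smult (lead_coeff (char_poly A)) (\<Prod>x\<in>#proots (char_poly A). [:-x, 1:])"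
    by (rule complex_poly_decompose_multiset [symmetric])
  also have "lead_coeff (char_poly A) = 1" using degree_monic_char_poly[OF assms(1)] by simp
  finally have "char_poly A = (\<Prod>x\<in>#mset es. [:-x, 1:])" unfolding assms(2) by simp
  thus ?thesis by (simp add: prod_mset_prod_list flip: mset_map)
qed

lemma mat_diag_mult_vec:
  assumes "c \<in> carrier_vec n"
  shows "mat_diag n d *\<^sub>v c = vec n (\<lambda>i. d i * c $ i)"
proof (rule eq_vecI)
  fix i assume "i < dim_vec (vec n (\<lambda>i. d i * c $ i))"
  hence i: "i < n" by simp
  have "(mat_diag n d *\<^sub>v c) $ i = (\<Sum>k<n. (if i = k then d k else 0) * c $ k)"
    using i assms unfolding mat_diag_def by (simp add: scalar_prod_def lessThan_atLeast0)
  also have "\<dots> = (\<Sum>k<n. if k = i then d i * c $ i else 0)" by (intro sum.cong) auto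
  finally show "(mat_diag n d *\<^sub>v c) $ i = vec n (\<lambda>i. d i * c $ i) $ i" using i by simp
qed (simp add: mat_diag_def)

lemma rinner_unitary:
  assumes "U \<in> carrier_mat n n" "mat_adjoint U * U = 1\<^sub>m n" "x \<in> carrier_vec n" "y \<in> carrier_vec n"
  shows "rinner (U *\<^sub>v x) (U *\<^sub>v y) = rinner x y"
proof -
  have "rinner (U *\<^sub>v x) (U *\<^sub>v y) = rinner x (mat_adjoint U *\<^sub>v (U *\<^sub>v y))"
    using assms by (intro rinner_adjoint) auto
  also have "mat_adjoint U *\<^sub>v (U *\<^sub>v y) = y"
    using assms mat_adjoint_carrier[OF assms(1)]
    by (metis assoc_mult_mat_vec one_mult_mat_vec)
  finally show ?thesis .
qed

lemma rinner_unitary_diag: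
  assumes U: "U \<in> carrier_mat n n" "mat_adjoint U * U = 1\<^sub>m n" and c: "c \<in> carrier_vec n"
  shows "rinner (U * mat_diag n d * mat_adjoint U *\<^sub>v (U *\<^sub>v c)) (U *\<^sub>v c)
    = (\<Sum>i<n. Re (d i) * (cmod (c $ i))\<^sup>2)"
proof -
  have U': "mat_adjoint U \<in> carrier_mat n n" using U by (intro mat_adjoint_carrier)
  have D: "mat_diag n d \<in> carrier_mat n n" by simp
  have "U * mat_diag n d * mat_adjoint U *\<^sub>v (U *\<^sub>v c)
      = U *\<^sub>v (mat_diag n d *\<^sub>v ((mat_adjoint U * U) *\<^sub>v c))"
    using U(1) U' c D by (simp add: assoc_mult_mat_vec[of _ n n _ n])
  also have "\<dots> = U *\<^sub>v (mat_diag n d *\<^sub>v c)" using U(2) c by simp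
  finally have "rinner (U * mat_diag n d * mat_adjoint U *\<^sub>v (U *\<^sub>v c)) (U *\<^sub>v c)
      = rinner (mat_diag n d *\<^sub>v c) c"
    using rinner_unitary[OF U, of "mat_diag n d *\<^sub>v c" c] c D by simp
  also have "\<dots> = (\<Sum>i<n. Re (d i) * (cmod (c $ i))\<^sup>2)"
    unfolding mat_diag_mult_vec[OF c] rinner_sum using c
    by (intro sum.cong) (auto simp: cmod_power2 power2_eq_square[of "Re _"] power2_eq_square[of "Im _"] algebra_simps)
  finally show ?thesis .
qed

section \<open>Singular values\<close>

text \<open>The columns of \<open>V\<close> are right singular vectors: the squared norm of
  \<open>X v\<close> is the quadratic form of \<open>X\<^sup>* X\<close> at \<open>v\<close>, which
  is diagonal in an eigenbasis.\<close>

lemma singular_values_diagonalisation: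
  assumes X: "X \<in> carrier_mat n n"
  obtains V where "V \<in> carrier_mat n n" "mat_adjoint V * V = 1\<^sub>m n"
    "\<And>c. c \<in> carrier_vec n \<Longrightarrow> rinner (X *\<^sub>v (V *\<^sub>v c)) (X *\<^sub>v (V *\<^sub>v c))
       = (\<Sum>i<n. (singular_values X ! i)\<^sup>2 * (cmod (c $ i))\<^sup>2)"
    "\<And>i. i < n \<Longrightarrow> singular_values X ! i \<ge> 0"
proof -
  define G where "G = mat_adjoint X * X"
  define f where "f = (\<lambda>z. sqrt (Re z))"
  have X': "mat_adjoint X \<in> carrier_mat n n" using X by (rule mat_adjoint_carrier)
  have G: "G \<in> carrier_mat n n" unfolding G_def using X X' by simp
  have herm: "mat_adjoint G = G"
    unfolding G_def using X X' by (simp add: mat_adjoint_mult[of _ n n _ n])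
  obtain es0 where es0: "mset es0 = proots (char_poly G)" using ex_mset by blast
  \<comment> \<open>Sorting the eigenvalues by their roots and reversing makes
    \<open>map f es\<close> literally the list \<open>singular_values X\<close>.\<close>
  define es where "es = rev (sort_key f es0)"
  have es: "mset es = proots (char_poly G)" unfolding es_def by (simp add: es0)
  have "sorted_list_of_multiset (image_mset f (mset es0)) = map f (sort_key f es0)"
    by (metis mset_map mset_sort properties_for_sort sorted_list_of_multiset_mset sorted_sort_key)
  hence sv: "singular_values X = map f es"
    unfolding singular_values_def G_def[symmetric] f_def[symmetric] es0[symmetric] es_def
    by (simp add: rev_map)
  have len: "length es = n" using length_singular_values[OF X] unfolding sv by simp
  obtain V where V: "V \<in> carrier_mat n n" and VV: "mat_adjoint V * V = 1\<^sub>m n"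
    and GV: "G = V * mat_diag n (\<lambda>i. es ! i) * mat_adjoint V"
    using hermitian_unitary_diagonalisation[OF G herm char_poly_complex_factor[OF G es]] by blast
  have form: "rinner (X *\<^sub>v (V *\<^sub>v c)) (X *\<^sub>v (V *\<^sub>v c)) = (\<Sum>i<n. Re (es ! i) * (cmod (c $ i))\<^sup>2)"
    if c: "c \<in> carrier_vec n" for c
  proof -
    have "rinner (G *\<^sub>v (V *\<^sub>v c)) (V *\<^sub>v c) = rinner (mat_adjoint X *\<^sub>v (X *\<^sub>v (V *\<^sub>v c))) (V *\<^sub>v c)"
      unfolding G_def using X X' V c by (simp add: assoc_mult_mat_vec[of _ n n _ n])
    also have "\<dots> = rinner (X *\<^sub>v (V *\<^sub>v c)) (X *\<^sub>v (V *\<^sub>v c))"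
      using rinner_adjoint[OF X', of "X *\<^sub>v (V *\<^sub>v c)" "V *\<^sub>v c"] X V c by simp
    finally show ?thesis using rinner_unitary_diag[OF V VV c, of "\<lambda>i. es ! i"] unfolding GV by simp
  qed
  \<comment> \<open>At the \<open>i\<close>-th unit vector the form reduces to this eigenvalue and
    is a squared norm. Hence squaring the root in \<open>f\<close> gives the eigenvalue
    back.\<close>
  have pos: "Re (es ! i) \<ge> 0" if i: "i < n" for i
  proof -
    have "(\<Sum>k<n. Re (es ! k) * (cmod (unit_vec n i $ k))\<^sup>2) = (\<Sum>k<n. if k = i then Re (es ! i) else 0)"
      using i by (intro sum.cong) auto
    thus ?thesis using form[of "unit_vec n i"] i rinner_nonneg[of "X *\<^sub>v (V *\<^sub>v unit_vec n i)"] by simp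
  qed
  show thesis
    by (rule that[OF V VV]) (use form pos len in \<open>auto simp: sv f_def\<close>)
qed

text \<open>A dimension count: \<open>k + 1\<close> free coordinates against \<open>k\<close> linear
  conditions.\<close>

lemma exists_kernel_vector_supported:
  fixes N :: "complex mat"
  assumes N: "N \<in> carrier_mat n n" and k: "k < n"
  obtains c where "c \<in> carrier_vec n" "c \<noteq> 0\<^sub>v n" "\<And>i. k < i \<Longrightarrow> i < n \<Longrightarrow> c $ i = 0"
    "\<And>i. i < k \<Longrightarrow> (N *\<^sub>v c) $ i = 0"
proof -
  \<comment> \<open>The \<open>n - 1\<close> homogeneous conditions, together with a zero row in position \<open>k\<close>.\<close>
  define M where "M = mat n n (\<lambda>(i, l). if i < k then N $$ (i, l)
    else if i = k then 0 else if l = i then 1 else 0)"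
  have M: "M \<in> carrier_mat n n" unfolding M_def by simp
  have "row M k = 0\<^sub>v n" unfolding M_def using k by (intro eq_vecI) auto
  hence "M = mat\<^sub>r n n (\<lambda>i. if i = k then 0\<^sub>v n else row M i)"
    using M by (intro eq_matI) (auto simp: row_def vec_eq_iff)
  hence "det M = 0" using det_row_0[OF k, of "row M"] M by fastforce
  then obtain c where c: "c \<in> carrier_vec n" "c \<noteq> 0\<^sub>v n" "M *\<^sub>v c = 0\<^sub>v n"
    using det_0_iff_vec_prod_zero[OF M] by auto
  have Mc: "row M i \<bullet> c = 0" if "i < n" for i
    using arg_cong[OF c(3), of "\<lambda>v. v $ i"] that M by simp
  have "c $ i = 0" if i: "k < i" "i < n" for i
  proof -
    have "row M i = unit_vec n i" unfolding M_def using i by (intro eq_vecI) auto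
    thus ?thesis using Mc[OF i(2)] c i by simp
  qed
  moreover have "(N *\<^sub>v c) $ i = 0" if i: "i < k" for i
  proof -
    have "row M i = row N i" unfolding M_def using i k N by (intro eq_vecI) auto
    thus ?thesis using Mc[of i] i k N by simp
  qed
  ultimately show thesis using that c by blast
qed

lemma singular_value_nonneg:
  assumes "X \<in> carrier_mat n n" "j \<in> {1..n}"
  shows "singular_value X j \<ge> 0"
proof -
  have "\<And>i. i < n \<Longrightarrow> singular_values X ! i \<ge> 0"
    by (rule singular_values_diagonalisation[OF assms(1)])
  thus ?thesis unfolding singular_value_def using assms by auto
qed

text \<open>
  The span of the first \<open>j\<close> right singular vectors of \<open>X\<close> contains a vector that \<open>L\<close> maps into the
  orthogonal complement of the first \<open>j - 1\<close> right singular vectors of \<open>Y\<close>.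
\<close>

lemma singular_value_minmax:
  assumes X: "X \<in> carrier_mat n n" and Y: "Y \<in> carrier_mat n n" and L: "L \<in> carrier_mat n n"
    and j: "j \<in> {1..n}"
  obtains z where "z \<in> carrier_vec n" "z \<noteq> 0\<^sub>v n"
    "(singular_value X j)\<^sup>2 * rinner z z \<le> rinner (X *\<^sub>v z) (X *\<^sub>v z)"
    "rinner (Y *\<^sub>v (L *\<^sub>v z)) (Y *\<^sub>v (L *\<^sub>v z)) \<le> (singular_value Y j)\<^sup>2 * rinner (L *\<^sub>v z) (L *\<^sub>v z)"
proof -
  \<comment> \<open>Lists are indexed from 0, so \<open>k\<close> is the list position of the
    \<open>j\<close>-th singular value.\<close>
  define k where "k = j - 1"
  have k: "k < n" using j by (auto simp: k_def)
  have anti: "singular_values Z ! b \<le> singular_values Z ! a"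
    if "Z \<in> carrier_mat n n" "a \<le> b" "b < n" for Z a b
    using antimono_singular_values[of Z] length_singular_values[OF that(1)] that
    by (cases "a = b") (auto simp: sorted_wrt_iff_nth_less)
  obtain V where V: "V \<in> carrier_mat n n" "mat_adjoint V * V = 1\<^sub>m n"
    and VX: "\<And>c. c \<in> carrier_vec n \<Longrightarrow> rinner (X *\<^sub>v (V *\<^sub>v c)) (X *\<^sub>v (V *\<^sub>v c))
       = (\<Sum>i<n. (singular_values X ! i)\<^sup>2 * (cmod (c $ i))\<^sup>2)"
    and posX: "\<And>i. i < n \<Longrightarrow> singular_values X ! i \<ge> 0"
    using singular_values_diagonalisation[OF X] by blast
  obtain W where W: "W \<in> carrier_mat n n" "mat_adjoint W * W = 1\<^sub>m n"
    and WY: "\<And>c. c \<in> carrier_vec n \<Longrightarrow> rinner (Y *\<^sub>v (W *\<^sub>v c)) (Y *\<^sub>v (W *\<^sub>v c))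
       = (\<Sum>i<n. (singular_values Y ! i)\<^sup>2 * (cmod (c $ i))\<^sup>2)"
    and posY: "\<And>i. i < n \<Longrightarrow> singular_values Y ! i \<ge> 0"
    using singular_values_diagonalisation[OF Y] by blast
  have W': "mat_adjoint W \<in> carrier_mat n n" using W by (intro mat_adjoint_carrier)
  have WW': "W * mat_adjoint W = 1\<^sub>m n" by (rule mat_mult_left_right_inverse[OF W' W])
  \<comment> \<open>\<open>N\<close> is \<open>L\<close> written in the right singular bases of
    \<open>X\<close> and \<open>Y\<close>; \<open>N *\<^sub>v c\<close> lists the coordinates of
    \<open>L *\<^sub>v z\<close> in the columns of \<open>W\<close>.\<close>
  define N where "N = mat_adjoint W * L * V"
  have N: "N \<in> carrier_mat n n" unfolding N_def using W' L V by simp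
  obtain c where c: "c \<in> carrier_vec n" "c \<noteq> 0\<^sub>v n" "\<And>i. k < i \<Longrightarrow> i < n \<Longrightarrow> c $ i = 0"
    "\<And>i. i < k \<Longrightarrow> (N *\<^sub>v c) $ i = 0"
    by (rule exists_kernel_vector_supported[OF N k]) blast
  define z where "z = V *\<^sub>v c"
  have z: "z \<in> carrier_vec n" unfolding z_def using V c by simp
  have zz: "rinner z z = (\<Sum>i<n. (cmod (c $ i))\<^sup>2)"
    unfolding z_def rinner_unitary[OF V c(1) c(1)] unfolding rinner_self_sum using c by simp
  have "rinner z z > 0"
    unfolding z_def rinner_unitary[OF V c(1) c(1)] by (rule rinner_pos[OF c(1,2)])
  hence z0: "z \<noteq> 0\<^sub>v n" by (auto simp: rinner_self_sum)
  have d: "N *\<^sub>v c \<in> carrier_vec n" using N c by simp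
  have "W *\<^sub>v (N *\<^sub>v c) = (W * mat_adjoint W) *\<^sub>v (L *\<^sub>v z)"
    unfolding N_def z_def using W(1) W' L V(1) c(1) by (simp add: assoc_mult_mat_vec[of _ n n _ n])
  hence Lz: "L *\<^sub>v z = W *\<^sub>v (N *\<^sub>v c)" unfolding WW' using L z by simp
  \<comment> \<open>Only coordinates up to \<open>k\<close> occur in \<open>c\<close>, and there the
    singular values of \<open>X\<close> are at least the \<open>j\<close>-th one.\<close>
  have "(singular_value X j)\<^sup>2 * rinner z z \<le> rinner (X *\<^sub>v z) (X *\<^sub>v z)"
    unfolding zz unfolding z_def VX[OF c(1)] sum_distrib_left
  proof (rule sum_mono)
    fix i assume "i \<in> {..<n}"
    thus "(singular_value X j)\<^sup>2 * (cmod (c $ i))\<^sup>2 \<le> (singular_values X ! i)\<^sup>2 * (cmod (c $ i))\<^sup>2"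
      using c(3)[of i] anti[OF X, of i k] k posX[of k]
      by (cases "k < i") (auto simp: singular_value_def k_def intro!: mult_right_mono power_mono)
  qed
  \<comment> \<open>The coordinates of \<open>L *\<^sub>v z\<close> before \<open>k\<close> vanish;
    from \<open>k\<close> on the singular values of \<open>Y\<close> are at most the
    \<open>j\<close>-th one.\<close>
  moreover have "rinner (Y *\<^sub>v (L *\<^sub>v z)) (Y *\<^sub>v (L *\<^sub>v z))
      \<le> (singular_value Y j)\<^sup>2 * rinner (L *\<^sub>v z) (L *\<^sub>v z)"
  proof -
    have "rinner (Y *\<^sub>v (L *\<^sub>v z)) (Y *\<^sub>v (L *\<^sub>v z))
        \<le> (\<Sum>i<n. (singular_value Y j)\<^sup>2 * (cmod ((N *\<^sub>v c) $ i))\<^sup>2)"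
      unfolding Lz WY[OF d]
    proof (rule sum_mono)
      fix i assume "i \<in> {..<n}"
      thus "(singular_values Y ! i)\<^sup>2 * (cmod ((N *\<^sub>v c) $ i))\<^sup>2
          \<le> (singular_value Y j)\<^sup>2 * (cmod ((N *\<^sub>v c) $ i))\<^sup>2"
        using c(4)[of i] anti[OF Y, of k i] posY[of i]
        by (cases "i < k") (auto simp: singular_value_def k_def intro!: mult_right_mono power_mono)
    qed
    also have "\<dots> = (singular_value Y j)\<^sup>2 * rinner (L *\<^sub>v z) (L *\<^sub>v z)"
      unfolding Lz rinner_unitary[OF W d d] unfolding rinner_self_sum using d N by (simp add: sum_distrib_left)
    finally show ?thesis .
  qed
  ultimately show thesis using that z z0 by blast
qed

section \<open>Square roots of positive semidefinite matrices\<close>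

lemma psd_diagonalisation:
  assumes A: "A \<in> carrier_mat n n" and psd: "positive_semidefinite A"
  obtains U d where "U \<in> carrier_mat n n" "mat_adjoint U * U = 1\<^sub>m n"
    "A = U * mat_diag n (\<lambda>i. complex_of_real (d i)) * mat_adjoint U" "\<And>i. d i \<ge> 0"
proof -
  have herm: "mat_adjoint A = A" using psd unfolding positive_semidefinite_def by simp
  obtain es where es: "mset es = proots (char_poly A)" using ex_mset by blast
  obtain U where U: "U \<in> carrier_mat n n" and UU: "mat_adjoint U * U = 1\<^sub>m n"
    and AU: "A = U * mat_diag n (\<lambda>i. es ! i) * mat_adjoint U"
    using hermitian_unitary_diagonalisation[OF A herm char_poly_complex_factor[OF A es]] by blast
  define D where "D = mat_diag n (\<lambda>i. es ! i)"
  have D: "D \<in> carrier_mat n n" unfolding D_def by simp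
  have U': "mat_adjoint U \<in> carrier_mat n n" using U by (rule mat_adjoint_carrier)
  have "mat_adjoint U * A * U = (mat_adjoint U * U) * D * (mat_adjoint U * U)"
    unfolding AU D_def[symmetric] using U U' D by (simp add: assoc_mult_mat[of _ n n _ n _ n])
  hence D_eq: "D = mat_adjoint U * A * U" using UU D by simp
  have D_herm: "mat_adjoint D = D"
    unfolding D_eq using U U' A herm
    by (simp add: mat_adjoint_mult[of _ n n _ n] assoc_mult_mat[of _ n n _ n _ n])
  \<comment> \<open>The diagonal matrix \<open>D\<close> is Hermitian along with \<open>A\<close>,
    so its entries equal their own conjugates.\<close>
  have real: "Im (es ! i) = 0" if "i < n" for i
  proof -
    have "mat_adjoint D $$ (i, i) = D $$ (i, i)" unfolding D_herm ..
    thus ?thesis using that D by (simp add: D_def mat_diag_def complex_eq_iff)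
  qed
  have pos: "Re (es ! i) \<ge> 0" if i: "i < n" for i
  proof -
    have "0 \<le> rinner (A *\<^sub>v (U *\<^sub>v unit_vec n i)) (U *\<^sub>v unit_vec n i)"
      using psd A U unfolding positive_semidefinite_def rinner_def by auto
    also have "\<dots> = (\<Sum>k<n. Re (es ! k) * (cmod (unit_vec n i $ k))\<^sup>2)"
      unfolding AU by (rule rinner_unitary_diag[OF U UU]) simp
    also have "\<dots> = (\<Sum>k<n. if k = i then Re (es ! i) else 0)" using i by (intro sum.cong) auto
    finally show ?thesis using i by simp
  qed
  \<comment> \<open>The maximum changes nothing at indices below \<open>n\<close> and makes
    \<open>d\<close> nonnegative at all indices.\<close>
  define d where "d i = max 0 (Re (es ! i))" for i
  have "D = mat_diag n (\<lambda>i. complex_of_real (d i))"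
    using real pos by (intro eq_matI) (auto simp: D_def d_def mat_diag_def complex_eq_iff)
  thus thesis using that[OF U UU, of d] AU D_def d_def by simp
qed

text \<open>One pair \<open>U\<close>, \<open>d\<close> serves all powers, so products of powers
  reduce to products of diagonal entries. The power 3/2 is given in both orders because
  \<open>a H b\<close> needs \<open>A\<close> to the right of \<open>a\<close> and \<open>B\<close>
  to the left of \<open>b\<close>.\<close>

lemma mat_powr_half_psd:
  assumes A: "A \<in> carrier_mat n n" and psd: "positive_semidefinite A"
  defines "a \<equiv> mat_powr A (1/2)"
  shows "a \<in> carrier_mat n n" "mat_adjoint a = a" "a * a = A"
    "mat_powr A (3/2) = a * A" "mat_powr A (3/2) = A * a"
proof -
  obtain U d where U: "U \<in> carrier_mat n n" and UU: "mat_adjoint U * U = 1\<^sub>m n"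
    and AU: "A = U * mat_diag n (\<lambda>i. complex_of_real (d i)) * mat_adjoint U" and d: "\<And>i. d i \<ge> 0"
    using psd_diagonalisation[OF A psd] by blast
  have U': "mat_adjoint U \<in> carrier_mat n n" using U by (rule mat_adjoint_carrier)
  define D where "D f = mat_diag n (\<lambda>i. complex_of_real (f i))" for f :: "nat \<Rightarrow> real"
  have D: "D f \<in> carrier_mat n n" for f unfolding D_def by simp
  define F where "F f = U * D f * mat_adjoint U" for f
  have F: "F f \<in> carrier_mat n n" for f unfolding F_def by (intro mult_carrier_mat[of _ n n] U U' D)
  have powr: "mat_powr A r = F (\<lambda>i. d i powr r)" for r
    unfolding mat_powr_def F_def D_def
  proof (rule spectral_fun_eqI, unfold is_spectral_fun_def, intro exI conjI)
    have dA: "dim_row A = n" using A by simp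
    show "unitary_mat U" "dim_row U = dim_row A" using U UU A by (auto simp: unitary_mat_def)
    show "A = U * mat_diag (dim_row A) (\<lambda>i. complex_of_real (d i)) * mat_adjoint U"
      unfolding dA by (rule AU)
    show "U * mat_diag n (\<lambda>i. complex_of_real (d i powr r)) * mat_adjoint U
        = U * mat_diag (dim_row A) (\<lambda>i. complex_of_real (d i powr r)) * mat_adjoint U"
      unfolding dA ..
  qed
  have mult: "F f * F g = F (\<lambda>i. f i * g i)" for f g
  proof -
    have "F f * F g = U * D f * (mat_adjoint U * U) * D g * mat_adjoint U"
      unfolding F_def using U U' D[of f] D[of g] by (simp add: assoc_mult_mat[of _ n n _ n _ n])
    also have "\<dots> = U * (D f * D g) * mat_adjoint U"
      unfolding UU using U U' D[of f] D[of g] by (simp add: assoc_mult_mat[of _ n n _ n _ n])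
    also have "D f * D g = D (\<lambda>i. f i * g i)" unfolding D_def by simp
    finally show ?thesis unfolding F_def .
  qed
  have a: "a = F (\<lambda>i. d i powr (1/2))" unfolding a_def by (rule powr)
  have A_F: "A = F d" unfolding F_def D_def by (rule AU)
  show "a \<in> carrier_mat n n" unfolding a by (rule F)
  have "mat_adjoint (D f) = D f" for f unfolding D_def by (simp add: mat_adjoint_mat_diag)
  thus "mat_adjoint a = a"
    unfolding a F_def using U U' D[of "\<lambda>i. d i powr (1/2)"]
    by (simp add: mat_adjoint_mult[of _ n n _ n] assoc_mult_mat[of _ n n _ n _ n])
  have sq: "d i powr (1/2) * d i powr (1/2) = d i" for i
    using d[of i] by (simp flip: powr_add)
  show "a * a = A" unfolding a mult sq A_F ..
  \<comment> \<open>Zero eigenvalues are covered as well, since \<open>0 powr r = 0\<close>.\<close>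
  have tri: "d i powr (3/2) = d i powr (1/2) * d i" for i
    using d[of i] powr_add[of "d i" "1/2" 1] by simp
  show "mat_powr A (3/2) = a * A" unfolding powr tri a unfolding A_F by (rule mult[symmetric])
  show "mat_powr A (3/2) = A * a" unfolding powr tri a unfolding A_F mult by (simp add: mult.commute)
qed

lemma smult_mat_mult_vec:
  fixes A :: "'a :: comm_semiring_0 mat"
  assumes "A \<in> carrier_mat n m" "x \<in> carrier_vec m"
  shows "(k \<cdot>\<^sub>m A) *\<^sub>v x = k \<cdot>\<^sub>v (A *\<^sub>v x)"
  using assms by (intro eq_vecI) (auto simp: scalar_prod_def sum_distrib_left mult.assoc)

section \<open>Singular value inequalities\<close>

text \<open>Min-max with \<open>L\<close> the identity gives one \<open>z\<close> at which
  \<open>H\<close> is bounded below and \<open>K\<close> above by their \<open>j\<close>-th singular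
  values. The form of \<open>K\<close> at \<open>z\<close> lies between the two bounds.\<close>

lemma singular_value_ge_of_real_part:
  assumes H: "H \<in> carrier_mat n n" and K: "K \<in> carrier_mat n n" and j: "j \<in> {1..n}" and c: "c \<ge> 0"
    and le: "\<And>z. z \<in> carrier_vec n \<Longrightarrow> c * rinner (H *\<^sub>v z) (H *\<^sub>v z) \<le> rinner (K *\<^sub>v z) z"
  shows "c * (singular_value H j)\<^sup>2 \<le> singular_value K j"
proof -
  obtain z where z: "z \<in> carrier_vec n" "z \<noteq> 0\<^sub>v n"
    and Hz: "(singular_value H j)\<^sup>2 * rinner z z \<le> rinner (H *\<^sub>v z) (H *\<^sub>v z)"
    and Kz: "rinner (K *\<^sub>v z) (K *\<^sub>v z) \<le> (singular_value K j)\<^sup>2 * rinner z z"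
    using singular_value_minmax[OF H K one_carrier_mat j] by (metis one_mult_mat_vec)
  have "c * ((singular_value H j)\<^sup>2 * rinner z z) \<le> c * rinner (H *\<^sub>v z) (H *\<^sub>v z)"
    by (rule mult_left_mono[OF Hz c])
  also have "\<dots> \<le> rinner (K *\<^sub>v z) z" by (rule le[OF z(1)])
  also have "\<dots> \<le> singular_value K j * rinner z z"
    using K z singular_value_nonneg[OF K j] Kz by (intro rinner_le_of_norm_le) auto
  finally have "(c * (singular_value H j)\<^sup>2) * rinner z z \<le> singular_value K j * rinner z z"
    by (simp add: mult.assoc)
  thus ?thesis using rinner_pos[OF z] by (simp add: mult_le_cancel_right)
qed

text \<open>With \<open>q = Q y\<close> and \<open>z = L y\<close>, the proof is the chain \<open>4
  s |q|\<^sup>2 \<le> <H z, z> \<le> h |z|\<^sup>2 \<le> 2 h\<^sup>2 |q|\<^sup>2\<close>, divided by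
  \<open>|q|\<^sup>2 > 0\<close>. If the singular value on the left is 0, the right side is a
  square.\<close>

lemma singular_value_sandwich_le:
  assumes a: "a \<in> carrier_mat n n" "mat_adjoint a = a" and b: "b \<in> carrier_mat n n" "mat_adjoint b = b"
    and j: "j \<in> {1..n}"
  defines "H \<equiv> a * a + b * b"
  shows "2 * singular_value (a * H * b) j \<le> (singular_value H j)\<^sup>2"
proof (cases "singular_value (a * H * b) j = 0")
  case False
  define Q where "Q = a * H * b"
  define s where "s = singular_value Q j"
  define h where "h = singular_value H j"
  have H: "H \<in> carrier_mat n n" unfolding H_def using a b by simp
  have Q: "Q \<in> carrier_mat n n" unfolding Q_def using a b H by simp
  have s: "s > 0" using False singular_value_nonneg[OF Q j] unfolding s_def Q_def by simp
  have h: "h \<ge> 0" unfolding h_def by (rule singular_value_nonneg[OF H j])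
  \<comment> \<open>\<open>L y = T\<^sup>* w\<close> for the block vector \<open>w = (Q y, s y)\<close>; taking \<open>Q y\<close> instead of the left singular
    vectors makes \<open>w\<close> linear in \<open>y\<close> without a polar decomposition.\<close>
  define L where "L = a * Q + complex_of_real s \<cdot>\<^sub>m b"
  have L: "L \<in> carrier_mat n n" unfolding L_def using a b Q by simp
  obtain y where y: "y \<in> carrier_vec n" "y \<noteq> 0\<^sub>v n"
    and Qy: "s\<^sup>2 * rinner y y \<le> rinner (Q *\<^sub>v y) (Q *\<^sub>v y)"
    and HL: "rinner (H *\<^sub>v (L *\<^sub>v y)) (H *\<^sub>v (L *\<^sub>v y)) \<le> h\<^sup>2 * rinner (L *\<^sub>v y) (L *\<^sub>v y)"
    using singular_value_minmax[OF Q H L j] unfolding s_def h_def by blast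
  define q where "q = Q *\<^sub>v y"
  define u where "u = a *\<^sub>v q"
  define v where "v = complex_of_real s \<cdot>\<^sub>v (b *\<^sub>v y)"
  define z where "z = u + v"
  \<comment> \<open>This is \<open>T\<^sup>*\<close> applied to the block vector with flipped sign,
    \<open>(Q y, - s y)\<close>.\<close>
  define z' where "z' = u + complex_of_real (-1) \<cdot>\<^sub>v v"
  have c [simp]: "q \<in> carrier_vec n" "u \<in> carrier_vec n" "v \<in> carrier_vec n" "z \<in> carrier_vec n"
    "z' \<in> carrier_vec n"
    unfolding q_def u_def v_def z_def z'_def using Q y a b by auto
  have Ly: "L *\<^sub>v y = z"
    unfolding L_def z_def u_def v_def q_def using a b Q y
    by (simp add: add_mult_distrib_mat_vec[of _ n n] assoc_mult_mat_vec[of _ n n _ n] smult_mat_mult_vec[of _ n n])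
  have selfadj: "rinner (a *\<^sub>v x) w = rinner x (a *\<^sub>v w)" "rinner (b *\<^sub>v x) w = rinner x (b *\<^sub>v w)"
    if "x \<in> carrier_vec n" "w \<in> carrier_vec n" for x w
    using rinner_adjoint[OF a(1) that] rinner_adjoint[OF b(1) that] a b by simp_all
  have Hx: "H *\<^sub>v x = a *\<^sub>v (a *\<^sub>v x) + b *\<^sub>v (b *\<^sub>v x)" if "x \<in> carrier_vec n" for x
    unfolding H_def using a b that
    by (simp add: add_mult_distrib_mat_vec[of _ n n] assoc_mult_mat_vec[of _ n n _ n])
  have Hform: "rinner (H *\<^sub>v x) w = rinner (a *\<^sub>v x) (a *\<^sub>v w) + rinner (b *\<^sub>v x) (b *\<^sub>v w)"
    if "x \<in> carrier_vec n" "w \<in> carrier_vec n" for x w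
    using that a b by (simp add: Hx rinner_add_left[of _ n] selfadj)
  have Hc: "H *\<^sub>v x \<in> carrier_vec n" if "x \<in> carrier_vec n" for x using H that by simp
  have Hadd: "H *\<^sub>v (x + w) = H *\<^sub>v x + H *\<^sub>v w" if "x \<in> carrier_vec n" "w \<in> carrier_vec n" for x w
    using H that by (rule mult_add_distrib_mat_vec)
  have Hsm: "H *\<^sub>v (r \<cdot>\<^sub>v x) = r \<cdot>\<^sub>v (H *\<^sub>v x)" if "x \<in> carrier_vec n" for x r
    using H that by (rule mult_mat_vec)
  have Hsym: "rinner (H *\<^sub>v u) v = rinner (H *\<^sub>v v) u"
    using a b by (simp add: Hform rinner_commute[of "a *\<^sub>v u"] rinner_commute[of "b *\<^sub>v u"])
  \<comment> \<open>Moving \<open>a\<close> across gives \<open>a H v = s a H b y = s q\<close>: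
    here the off-diagonal block \<open>Q\<close> appears.\<close>
  have cross: "rinner (H *\<^sub>v v) u = s * rinner q q"
  proof -
    have "rinner (H *\<^sub>v v) u = rinner (a *\<^sub>v (H *\<^sub>v v)) q"
      unfolding u_def using Hc by (simp add: selfadj)
    also have "a *\<^sub>v (H *\<^sub>v v) = complex_of_real s \<cdot>\<^sub>v q"
      unfolding v_def q_def Q_def using a b H y
      by (simp add: Hsm mult_mat_vec[of _ n n] assoc_mult_mat_vec[of _ n n _ n])
    finally show ?thesis by (simp add: rinner_smult_left[of _ n])
  qed
  \<comment> \<open>Nonnegativity at \<open>z'\<close> bounds the two diagonal terms below by twice
    the cross term, so the form at \<open>z\<close> is at least four times the cross term.\<close>
  have "0 \<le> rinner (H *\<^sub>v z') z'" by (simp add: Hform)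
  also have "rinner (H *\<^sub>v z') z' = rinner (H *\<^sub>v u) u - 2 * rinner (H *\<^sub>v v) u + rinner (H *\<^sub>v v) v"
    unfolding z'_def
    by (simp del: of_real_minus add: Hadd Hsm Hc Hsym rinner_add_left[of _ n] rinner_add_right[of _ n]
        rinner_smult_left[of _ n] rinner_smult_right[of _ n])
  finally have "4 * rinner (H *\<^sub>v v) u \<le> rinner (H *\<^sub>v z) z"
    unfolding z_def
    by (simp add: Hadd Hc Hsym rinner_add_left[of _ n] rinner_add_right[of _ n])
  hence lower: "4 * s * rinner q q \<le> rinner (H *\<^sub>v z) z" unfolding cross by simp
  have Hz: "rinner (H *\<^sub>v z) z \<le> h * rinner z z"
    using HL h unfolding Ly by (intro rinner_le_of_norm_le[of _ n]) (auto intro: Hc)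
  have q0: "rinner q q > 0"
  proof -
    have "0 < s\<^sup>2 * rinner y y" using s rinner_pos[OF y] by simp
    thus ?thesis using Qy unfolding q_def by linarith
  qed
  \<comment> \<open>The next estimate divides by \<open>h\<close>; if \<open>h\<close> were 0, the
    lower bound would contradict \<open>s > 0\<close> and \<open>q0\<close>.\<close>
  have h0: "h > 0"
  proof (rule ccontr)
    assume "\<not> h > 0"
    hence "4 * s * rinner q q \<le> 0" using lower Hz h by simp
    moreover have "4 * s * rinner q q > 0" using s q0 by simp
    ultimately show False by linarith
  qed
  \<comment> \<open>The bound on \<open>H\<close> is known only at \<open>z\<close>. Pairing
    \<open>(q, s y)\<close> with \<open>(a z, b z)\<close> at weight \<open>h\<close> bounds
    \<open>2 |z|\<^sup>2\<close>; the term \<open><H z, z> / h\<close> is at most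
    \<open>|z|\<^sup>2\<close> and is absorbed. The choice of \<open>y\<close> then gives
    \<open>s\<^sup>2 |y|\<^sup>2 \<le> |q|\<^sup>2\<close>.\<close>
  have "rinner z z \<le> h * (2 * rinner q q)"
  proof -
    let ?sy = "complex_of_real s \<cdot>\<^sub>v y"
    have "rinner z z = rinner u z + rinner v z" unfolding z_def by (rule rinner_add_left[of _ n]) (use c in \<open>auto simp: z_def\<close>)
    also have "rinner u z = rinner q (a *\<^sub>v z)" unfolding u_def by (simp add: selfadj)
    also have "rinner v z = rinner ?sy (b *\<^sub>v z)"
      unfolding v_def using y b by (simp add: rinner_smult_left[of _ n] selfadj)
    finally have "2 * rinner z z = 2 * rinner q (a *\<^sub>v z) + 2 * rinner ?sy (b *\<^sub>v z)" by simp
    also have "\<dots> \<le> (h * rinner q q + rinner (a *\<^sub>v z) (a *\<^sub>v z) / h)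
        + (h * rinner ?sy ?sy + rinner (b *\<^sub>v z) (b *\<^sub>v z) / h)"
      using a b y h0 by (intro add_mono rinner_le_AM_GM[of _ n]) auto
    also have "\<dots> = h * (rinner q q + rinner ?sy ?sy) + rinner (H *\<^sub>v z) z / h"
      by (simp add: Hform algebra_simps add_divide_distrib)
    also have "rinner (H *\<^sub>v z) z / h \<le> rinner z z" using Hz h0 by (simp add: field_simps)
    also have "rinner ?sy ?sy = s\<^sup>2 * rinner y y"
      using y by (simp add: rinner_smult_left[of _ n] rinner_smult_right[of _ n] power2_eq_square)
    finally have "rinner z z \<le> h * (rinner q q + s\<^sup>2 * rinner y y)" by simp
    also have "\<dots> \<le> h * (2 * rinner q q)" using Qy h unfolding q_def by (intro mult_left_mono) auto
    finally show ?thesis .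
  qed
  hence "h * rinner z z \<le> h * (h * (2 * rinner q q))" using h by (intro mult_left_mono)
  hence "4 * s * rinner q q \<le> 2 * h\<^sup>2 * rinner q q"
    using lower Hz by (simp add: power2_eq_square mult_ac)
  hence "4 * s \<le> 2 * h\<^sup>2" using q0 by (simp add: mult_le_cancel_right)
  thus ?thesis unfolding s_def h_def Q_def by simp
qed auto

theorem proposition4p1:
  fixes n j :: nat and A B :: "complex mat" and t :: real
  assumes "n \<ge> 1"
    and "A \<in> carrier_mat n n" and "B \<in> carrier_mat n n"
    and "positive_semidefinite A" and "positive_semidefinite B"
    and "j \<in> {1..n}"
    and "t \<in> {-2<..2}"
  shows "(2 + t) * singular_value
           (mat_powr A (1/2) * mat_powr B (3/2) + mat_powr A (3/2) * mat_powr B (1/2)) j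
       \<le> 2 * singular_value (A ^\<^sub>m 2 + complex_of_real t \<cdot>\<^sub>m (A * B) + B ^\<^sub>m 2) j"
proof -
  define a b where "a = mat_powr A (1/2)" and "b = mat_powr B (1/2)"
  note A = assms(2) and B = assms(3) and j = assms(6)
  note ha = mat_powr_half_psd[OF A assms(4), folded a_def]
  note hb = mat_powr_half_psd[OF B assms(5), folded b_def]
  define H where "H = A + B"
  have H: "H \<in> carrier_mat n n" unfolding H_def using A B by simp
  have adj: "mat_adjoint A = A" "mat_adjoint B = B"
    using assms(4,5) unfolding positive_semidefinite_def by auto
  \<comment> \<open>With \<open>A = a\<^sup>2\<close> and \<open>B = b\<^sup>2\<close>, the sum is
    \<open>a B b + a A b\<close>.\<close>
  have Q: "a * mat_powr B (3/2) + mat_powr A (3/2) * b = a * H * b"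
    unfolding ha(4) hb(5) H_def using A B ha(1) hb(1)
    by (simp add: mult_add_distrib_mat[of _ n n _ n] add_mult_distrib_mat[of _ n n _ _ n]
        assoc_mult_mat[of _ n n _ n _ n] comm_add_mat[of _ n n])
  have upper: "2 * singular_value (a * H * b) j \<le> (singular_value H j)\<^sup>2"
    using singular_value_sandwich_le[OF ha(1,2) hb(1,2) j] unfolding ha(3) hb(3) H_def .
  define K where "K = A * A + complex_of_real t \<cdot>\<^sub>m (A * B) + B * B"
  have K: "K \<in> carrier_mat n n" unfolding K_def using A B by simp
  have K_eq: "A ^\<^sub>m 2 + complex_of_real t \<cdot>\<^sub>m (A * B) + B ^\<^sub>m 2 = K"
    unfolding K_def using A B by (simp add: numeral_2_eq_2)
  have "(2 + t) / 4 * (singular_value H j)\<^sup>2 \<le> singular_value K j"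
  proof (rule singular_value_ge_of_real_part[OF H K j])
    show "0 \<le> (2 + t) / 4" using assms(7) by simp
    fix z :: "complex vec" assume z: "z \<in> carrier_vec n"
    define x y where "x = A *\<^sub>v z" and "y = B *\<^sub>v z"
    have c: "x \<in> carrier_vec n" "y \<in> carrier_vec n" unfolding x_def y_def using A B z by auto
    have yx: "rinner y x = rinner x y" using c by (intro rinner_commute) simp
    have Hz: "H *\<^sub>v z = x + y"
      unfolding H_def x_def y_def using A B z by (simp add: add_mult_distrib_mat_vec[of _ n n])
    have Kz: "K *\<^sub>v z = A *\<^sub>v x + complex_of_real t \<cdot>\<^sub>v (A *\<^sub>v y) + B *\<^sub>v y"
      unfolding K_def x_def y_def using A B z
      by (simp add: add_mult_distrib_mat_vec[of _ n n] assoc_mult_mat_vec[of _ n n _ n]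
        smult_mat_mult_vec[of _ n n])
    have "rinner (K *\<^sub>v z) z = rinner (A *\<^sub>v x) z + t * rinner (A *\<^sub>v y) z + rinner (B *\<^sub>v y) z"
      unfolding Kz using A B c z by (simp add: rinner_add_left[of _ n] rinner_smult_left[of _ n])
    also have "\<dots> = rinner x x + t * rinner x y + rinner y y"
      using rinner_adjoint[OF A c(1) z] rinner_adjoint[OF A c(2) z] rinner_adjoint[OF B c(2) z]
      by (simp add: adj yx flip: x_def y_def)
    finally have K_form: "rinner (K *\<^sub>v z) z = rinner x x + t * rinner x y + rinner y y" .
    have H_form: "rinner (H *\<^sub>v z) (H *\<^sub>v z) = rinner x x + 2 * rinner x y + rinner y y"
      unfolding Hz using c by (simp add: rinner_add_left[of _ n] rinner_add_right[of _ n] yx)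
    \<comment> \<open>This says that the squared norm of \<open>(A - B) z\<close> is nonnegative;
      its coefficient \<open>(2 - t) / 4\<close> is nonnegative because
      \<open>t \<le> 2\<close>.\<close>
    have "2 * rinner x y \<le> rinner x x + rinner y y" using rinner_le_AM_GM[OF c, of 1] by simp
    hence "0 \<le> (2 - t) / 4 * (rinner x x - 2 * rinner x y + rinner y y)"
      using assms(7) by (intro mult_nonneg_nonneg) auto
    also have "\<dots> = rinner (K *\<^sub>v z) z - (2 + t) / 4 * rinner (H *\<^sub>v z) (H *\<^sub>v z)"
      unfolding K_form H_form by (simp add: field_simps)
    finally show "(2 + t) / 4 * rinner (H *\<^sub>v z) (H *\<^sub>v z) \<le> rinner (K *\<^sub>v z) z" by simp
  qed
  \<comment> \<open>Since \<open>t > -2\<close>, the sandwich bound may be multiplied by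
    \<open>2 + t\<close>.\<close>
  moreover have "(2 + t) * (2 * singular_value (a * H * b) j) \<le> (2 + t) * (singular_value H j)\<^sup>2"
    using upper assms(7) by (intro mult_left_mono) auto
  ultimately have "(2 + t) * singular_value (a * H * b) j \<le> 2 * singular_value K j" by simp
  thus ?thesis unfolding K_eq using Q unfolding a_def b_def by simp
qed

end
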